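(* Every generalized ellipsoid is an SDP-representable set.
   Context: A set $\mathcal{E}_d\subset\mathbb{R}^n$ is a generalized ellipsoid of degree $d$ if it can be written as $\mathcal{E}_d=\{x\in\mathbb{R}^n\mid (x-x_0)^TP(t)(x-x_0)\le 1\ \ \forall t\in[-1,1]\}$ for some vector $x_0\in\mathbb{R}^n$ and some univariate polynomial matrix $P(t)$ (a real symmetric $n\times n$ matrix whose entries are polynomials in $t$) of degree at most $d$ that satisfies $P(t)\succeq 0$ for all $t\in[-1,1]$ and $\bigcap_{t\in[-1,1]}\mathrm{Ker}(P(t))=\{0\}$. A set is a generalized ellipsoid if it is a generalized ellipsoid of degree $d$ for some nonnegative integer $d$. A set $\Omega\subseteq\mathbb{R}^n$ is SDP-representable if $$\Omega=\left\{x\in\mathbb{R}^n\ \middle|\ \exists y\in\mathbb{R}^k \text{ such that } A_0+\sum_{i=1}^n x_iA_i+\sum_{i=1}^k y_iB_i\succeq 0\right\}$$ for some integer $k\ge 0$ and some real symmetric $m\times m$ matrices $A_0,A_1,\dots,A_n,B_1,\dots,B_k$ (for some $m$), where $\succeq 0$ means positive semidefinite. *)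

theory Defs
  imports
    "HOL-Computational_Algebra.Polynomial"
    "Jordan_Normal_Form.Matrix_Kernel"
begin

text \<open>
  The space \<open>\<real>\<^sup>n\<close> is \<open>carrier_vec n\<close> over the reals, and coordinates are indexed from \<open>0\<close>.
\<close>

definition psd_mat :: "real mat \<Rightarrow> bool" where
  "psd_mat A \<longleftrightarrow> square_mat A \<and> transpose_mat A = A \<and>
     (\<forall>v \<in> carrier_vec (dim_row A). 0 \<le> v \<bullet> (A *\<^sub>v v))"

definition eval_poly_mat :: "real poly mat \<Rightarrow> real \<Rightarrow> real mat" where
  "eval_poly_mat P t = map_mat (\<lambda>p. poly p t) P"

definition is_generalized_ellipsoid_of_degree :: "nat \<Rightarrow> nat \<Rightarrow> real vec set \<Rightarrow> bool" where
  "is_generalized_ellipsoid_of_degree n d E \<longleftrightarrow>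
     (\<exists>x0 \<in> carrier_vec n. \<exists>P \<in> carrier_mat n n.
        transpose_mat P = P \<and>
        (\<forall>i<n. \<forall>j<n. degree (P $$ (i, j)) \<le> d) \<and>
        (\<forall>t \<in> {-1..1}. psd_mat (eval_poly_mat P t)) \<and>
        (\<Inter>t \<in> {-1..1}. mat_kernel (eval_poly_mat P t)) = {0\<^sub>v n} \<and>
        E = {x \<in> carrier_vec n.
               \<forall>t \<in> {-1..1}. (x - x0) \<bullet> (eval_poly_mat P t *\<^sub>v (x - x0)) \<le> 1})"

definition is_generalized_ellipsoid :: "nat \<Rightarrow> real vec set \<Rightarrow> bool" where
  "is_generalized_ellipsoid n E \<longleftrightarrow> (\<exists>d. is_generalized_ellipsoid_of_degree n d E)"

text \<open>
  The matrix \<open>A\<^sub>0 + (\<Sum>i. x\<^sub>i A\<^sub>i) + (\<Sum>i. y\<^sub>i B\<^sub>i)\<close> of size \<open>m\<close>, written entrywise because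
  \<open>sum\<close> is not available on the type of matrices of arbitrary dimension.  The coordinate
  \<open>x\<^sub>i\<close> with \<open>1 \<le> i \<le> n\<close> is \<open>x $ (i - 1)\<close>, so it is multiplied with \<open>A (Suc (i - 1))\<close>; the
  matrices \<open>B\<close> are indexed from \<open>0\<close>.
\<close>
definition linear_pencil ::
  "nat \<Rightarrow> nat \<Rightarrow> nat \<Rightarrow> (nat \<Rightarrow> real mat) \<Rightarrow> (nat \<Rightarrow> real mat) \<Rightarrow> real vec \<Rightarrow> real vec \<Rightarrow> real mat" where
  "linear_pencil m n k A B x y =
     mat m m (\<lambda>rs. A 0 $$ rs + (\<Sum>i<n. x $ i * A (Suc i) $$ rs) + (\<Sum>i<k. y $ i * B i $$ rs))"

definition sdp_representable :: "nat \<Rightarrow> real vec set \<Rightarrow> bool" where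
  "sdp_representable n S \<longleftrightarrow>
     (\<exists>k m A B.
        (\<forall>i\<le>n. A i \<in> carrier_mat m m \<and> transpose_mat (A i) = A i) \<and>
        (\<forall>i<k. B i \<in> carrier_mat m m \<and> transpose_mat (B i) = B i) \<and>
        S = {x \<in> carrier_vec n. \<exists>y \<in> carrier_vec k. psd_mat (linear_pencil m n k A B x y)})"

end

theory Submission
  imports Defs "HOL-Computational_Algebra.Fundamental_Theorem_Algebra"
begin

text \<open>
  Write \<open>u = x - x\<^sub>0\<close>. The condition \<open>u\<^sup>T P(t) u \<le> 1\<close> for all \<open>t \<in> [-1, 1]\<close> says that a univariate
  polynomial is nonnegative on an interval, and such a condition is a linear matrix inequality in the
  coefficients of the polynomial and some auxiliary variables. The obstacle is that the coefficients
  are quadratic in \<open>x\<close>. It is removed by a relaxation that turns out to be exact: introduce a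
  symmetric matrix \<open>Y\<close> with \<open>Y - u u\<^sup>T\<close> positive semidefinite and demand
  \<open>p(t) = 1 - tr (P(t) Y) \<ge> 0\<close> on \<open>[-1, 1]\<close> instead. Since \<open>P(t)\<close> is positive semidefinite,
  \<open>tr (P(t) Y) \<ge> u\<^sup>T P(t) u\<close> (lemma \<open>psd_on_trace_nonneg\<close>), so that the relaxed condition implies the
  original one; and \<open>Y = u u\<^sup>T\<close> gives back the original condition. The requirement on \<open>Y\<close> is linear
  in \<open>(x, Y)\<close> when it is written as positive semidefiniteness of \<open>Y\<close> bordered by \<open>u\<close> and \<open>1\<close>.

  It remains to express \<open>p \<ge> 0\<close> on \<open>[-1, 1]\<close> for \<open>p\<close> of degree at most \<open>d\<close>. The substitution
  \<open>t = 2 s / (1 + s\<^sup>2)\<close> turns it into nonnegativity on the whole line of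
  \<open>(1 + s\<^sup>2)\<^sup>d p (2 s / (1 + s\<^sup>2))\<close>, a polynomial of degree at most \<open>2 d\<close>. A nonnegative univariate
  polynomial is a sum of squares, hence of the form \<open>\<Sum>i j. G i j s\<^sup>i\<^sup>+\<^sup>j\<close> with a positive semidefinite
  Gram matrix \<open>G\<close> (lemma \<open>poly_nonneg_interval_iff_gram\<close>). The equality of the two polynomials is
  tested at \<open>2 d + 1\<close> points, which gives finitely many equations that are affine in \<open>(Y, G)\<close>.

  All these conditions are combined into one block diagonal pencil whose size and number of variables
  never need to be computed: conditions definable by linear matrix inequalities are closed under
  conjunction, and their projections are SDP-representable
  (lemma \<open>lmi_definable_imp_sdp_representable\<close>).
\<close>

section \<open>Positive semidefinite kernels on finite index sets\<close>

text \<open>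
  Only the quadratic form is restricted here; symmetry is stated separately where it matters. An
  arbitrary index type allows block matrices to be indexed by disjoint sums.
\<close>
definition psd_on :: "'i set \<Rightarrow> ('i \<Rightarrow> 'i \<Rightarrow> real) \<Rightarrow> bool" where
  "psd_on I F \<longleftrightarrow> (\<forall>v. 0 \<le> (\<Sum>i\<in>I. \<Sum>j\<in>I. v i * F i j * v j))"

lemma psd_onD: "psd_on I F \<Longrightarrow> 0 \<le> (\<Sum>i\<in>I. \<Sum>j\<in>I. v i * F i j * v j)"
  by (simp add: psd_on_def)

lemma psd_on_cong:
  assumes "\<And>i j. i \<in> I \<Longrightarrow> j \<in> I \<Longrightarrow> F i j = G i j"
  shows "psd_on I F \<longleftrightarrow> psd_on I G"
  unfolding psd_on_def using assms by (simp cong: sum.cong)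

lemma psd_on_rank_one: "psd_on I (\<lambda>i j. a i * a j)"
proof -
  have "(\<Sum>i\<in>I. \<Sum>j\<in>I. v i * (a i * a j) * v j) = (\<Sum>i\<in>I. v i * a i)\<^sup>2" for v
    by (simp add: power2_eq_square sum_product mult_ac)
  then show ?thesis
    by (simp add: psd_on_def)
qed

lemma psd_on_add:
  assumes "psd_on I F" "psd_on I G"
  shows "psd_on I (\<lambda>i j. F i j + G i j)"
proof -
  have "(\<Sum>i\<in>I. \<Sum>j\<in>I. v i * (F i j + G i j) * v j) =
      (\<Sum>i\<in>I. \<Sum>j\<in>I. v i * F i j * v j) + (\<Sum>i\<in>I. \<Sum>j\<in>I. v i * G i j * v j)" for v
    by (simp add: algebra_simps sum.distrib)
  then show ?thesis
    using assms by (simp add: psd_on_def)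
qed

lemma psd_on_reindex:
  assumes "inj_on h I"
  shows "psd_on (h ` I) F \<longleftrightarrow> psd_on I (\<lambda>i j. F (h i) (h j))"
proof
  assume "psd_on (h ` I) F"
  show "psd_on I (\<lambda>i j. F (h i) (h j))"
    unfolding psd_on_def
  proof
    fix v
    have "(\<Sum>i\<in>h ` I. \<Sum>j\<in>h ` I. (v \<circ> inv_into I h) i * F i j * (v \<circ> inv_into I h) j)
       = (\<Sum>i\<in>I. \<Sum>j\<in>I. v i * F (h i) (h j) * v j)"
      using assms by (simp add: sum.reindex)
    then show "0 \<le> (\<Sum>i\<in>I. \<Sum>j\<in>I. v i * F (h i) (h j) * v j)"
      using psd_onD[OF \<open>psd_on (h ` I) F\<close>, of "v \<circ> inv_into I h"] by simp
  qed
next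
  assume *: "psd_on I (\<lambda>i j. F (h i) (h j))"
  show "psd_on (h ` I) F"
    unfolding psd_on_def using psd_onD[OF *, of "v \<circ> h" for v] assms by (simp add: sum.reindex)
qed

lemma psd_on_subset:
  assumes "psd_on I F" "finite I" "J \<subseteq> I"
  shows "psd_on J F"
  unfolding psd_on_def
proof
  fix v :: "_ \<Rightarrow> real"
  define w where "w i = (if i \<in> J then v i else 0)" for i
  have "(\<Sum>j\<in>I. w i * F i j * w j) = (\<Sum>j\<in>J. w i * F i j * v j)" for i
    using assms(2,3) by (intro sum.mono_neutral_cong_right) (auto simp: w_def finite_subset[OF assms(3,2)])
  then have "(\<Sum>i\<in>I. \<Sum>j\<in>I. w i * F i j * w j) = (\<Sum>i\<in>I. \<Sum>j\<in>J. w i * F i j * v j)"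
    by simp
  also have "\<dots> = (\<Sum>i\<in>J. \<Sum>j\<in>J. v i * F i j * v j)"
    using assms(2,3) by (intro sum.mono_neutral_cong_right) (auto simp: w_def finite_subset[OF assms(3,2)])
  finally show "0 \<le> (\<Sum>i\<in>J. \<Sum>j\<in>J. v i * F i j * v j)"
    using psd_onD[OF assms(1), of w] by simp
qed

fun block_diag :: "('i \<Rightarrow> 'i \<Rightarrow> real) \<Rightarrow> ('j \<Rightarrow> 'j \<Rightarrow> real) \<Rightarrow> 'i + 'j \<Rightarrow> 'i + 'j \<Rightarrow> real" where
  "block_diag F G (Inl i) (Inl j) = F i j"
| "block_diag F G (Inr i) (Inr j) = G i j"
| "block_diag F G _ _ = 0"

lemma psd_on_block_diag:
  assumes "finite I" "finite J"
  shows "psd_on (I <+> J) (block_diag F G) \<longleftrightarrow> psd_on I F \<and> psd_on J G"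
proof -
  have eq: "(\<Sum>i\<in>I <+> J. \<Sum>j\<in>I <+> J. v i * block_diag F G i j * v j) =
      (\<Sum>i\<in>I. \<Sum>j\<in>I. v (Inl i) * F i j * v (Inl j)) +
      (\<Sum>i\<in>J. \<Sum>j\<in>J. v (Inr i) * G i j * v (Inr j))" for v
    using assms by (simp add: sum.Plus)
  show ?thesis
  proof safe
    assume *: "psd_on (I <+> J) (block_diag F G)"
    show "psd_on I F" unfolding psd_on_def
      using psd_onD[OF *, of "case_sum v (\<lambda>_. 0)" for v] unfolding eq by simp
    show "psd_on J G" unfolding psd_on_def
      using psd_onD[OF *, of "case_sum (\<lambda>_. 0) v" for v] unfolding eq by simp
  next
    assume "psd_on I F" "psd_on J G"
    then show "psd_on (I <+> J) (block_diag F G)"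
      unfolding psd_on_def[of "I <+> J"] eq by (simp add: psd_onD)
  qed
qed

text \<open>
  The induction splits off one index \<open>k\<close> by a step of Gaussian elimination on \<open>A\<close>. If \<open>A k k > 0\<close>,
  the Schur complement is again positive semidefinite, and the rank-one matrix removed from \<open>A\<close>
  contributes a value of the quadratic form of \<open>B\<close>. If \<open>A k k = 0\<close>, the whole row \<open>k\<close> of \<open>A\<close> vanishes.
\<close>
lemma psd_on_trace_nonneg:
  assumes "finite I" "psd_on I A" "psd_on I B"
    and "\<And>i j. i \<in> I \<Longrightarrow> j \<in> I \<Longrightarrow> A i j = A j i"
  shows "0 \<le> (\<Sum>i\<in>I. \<Sum>j\<in>I. A i j * B i j)"
  using assms
proof (induction I arbitrary: A rule: finite_induct)
  case empty
  then show ?case by simp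
next
  case (insert k J)
  note fin = insert.hyps(1) and k = insert.hyps(2)
  have symk: "A i k = A k i" if "i \<in> J" for i
    using insert.prems(3) that by blast
  have psdB: "psd_on J B"
    using psd_on_subset[OF insert.prems(2)] fin by blast
  \<comment> \<open>The quadratic form of \<open>A\<close> at a vector with \<open>k\<close>-th coordinate \<open>w\<close>.\<close>
  have quad: "0 \<le> A k k * w\<^sup>2 + 2 * w * (\<Sum>i\<in>J. A k i * v i) + (\<Sum>i\<in>J. \<Sum>j\<in>J. v i * A i j * v j)"
    for w v
  proof -
    have "(\<Sum>i\<in>insert k J. \<Sum>j\<in>insert k J. (v(k := w)) i * A i j * (v(k := w)) j)
      = w * A k k * w + (\<Sum>j\<in>J. w * A k j * v j) + (\<Sum>i\<in>J. v i * A i k * w + (\<Sum>j\<in>J. v i * A i j * v j))"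
    proof -
      have "(\<Sum>j\<in>J. a * A i j * (v(k := w)) j) = (\<Sum>j\<in>J. a * A i j * v j)" for a i
        using k by (intro sum.cong) auto
      moreover have "(\<Sum>i\<in>J. (v(k := w)) i * A i k * w + (\<Sum>j\<in>J. (v(k := w)) i * A i j * v j))
          = (\<Sum>i\<in>J. v i * A i k * w + (\<Sum>j\<in>J. v i * A i j * v j))"
        using k by (intro sum.cong) auto
      ultimately show ?thesis
        using fin k by simp
    qed
    also have "\<dots> = A k k * w\<^sup>2 + 2 * w * (\<Sum>i\<in>J. A k i * v i) + (\<Sum>i\<in>J. \<Sum>j\<in>J. v i * A i j * v j)"
    proof -
      have "(\<Sum>i\<in>J. v i * A i k * w) = w * (\<Sum>i\<in>J. A k i * v i)"
        by (simp add: sum_distrib_left symk mult_ac)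
      moreover have "(\<Sum>i\<in>J. w * A k i * v i) = w * (\<Sum>i\<in>J. A k i * v i)"
        by (simp add: sum_distrib_left mult_ac)
      ultimately show ?thesis
        by (simp add: sum.distrib power2_eq_square mult_ac)
    qed
    finally show ?thesis
      using psd_onD[OF insert.prems(1), of "v(k := w)"] by simp
  qed
  have Akk: "0 \<le> A k k"
    using quad[of 1 "\<lambda>_. 0"] by simp
  have split: "(\<Sum>i\<in>insert k J. \<Sum>j\<in>insert k J. A i j * B i j) =
      A k k * B k k + (\<Sum>j\<in>J. A k j * B k j) + (\<Sum>i\<in>J. A k i * B i k) + (\<Sum>i\<in>J. \<Sum>j\<in>J. A i j * B i j)"
    using fin k by (simp add: sum.distrib symk)
  show ?case
  proof (cases "A k k = 0")
    case True
    have zero: "A k i = 0" if "i \<in> J" for i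
    proof (rule ccontr)
      assume "A k i \<noteq> 0"
      \<comment> \<open>The form at \<open>w e\<^sub>k + e\<^sub>i\<close> is linear in \<open>w\<close>; this \<open>w\<close> makes it \<open>-1\<close>.\<close>
      define w where "w = - (A i i + 1) / (2 * A k i)"
      have "(\<Sum>j\<in>J. A k j * of_bool (j = i)) = A k i"
        using that fin by (simp add: of_bool_def if_distrib sum.delta' cong: if_cong)
      moreover have "(\<Sum>l\<in>J. \<Sum>j\<in>J. of_bool (l = i) * A l j * of_bool (j = i)) = A i i"
      proof -
        have "of_bool (l = i) * A l j * of_bool (j = i) =
            (if j = i then if l = i then A i i else 0 else 0)" for l j
          by simp
        then show ?thesis
          using that fin by simp
      qed
      ultimately have "0 \<le> 2 * w * A k i + A i i"
        using quad[of w "\<lambda>j. of_bool (j = i)"] True by simp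
      also have "\<dots> = -1"
        using \<open>A k i \<noteq> 0\<close> by (simp add: w_def field_simps)
      finally show False by simp
    qed
    have "psd_on J A"
      unfolding psd_on_def using quad[of 0] by simp
    then have "0 \<le> (\<Sum>i\<in>J. \<Sum>j\<in>J. A i j * B i j)"
      using insert.IH psdB insert.prems(3) by blast
    then show ?thesis
      unfolding split using True zero by simp
  next
    case False
    then have pos: "A k k > 0" using Akk by simp
    define A' where "A' i j = A i j - A k i * A k j / A k k" for i j
    have "psd_on J A'"
      unfolding psd_on_def
    proof
      fix v
      let ?b = "\<Sum>i\<in>J. A k i * v i"
      have "(\<Sum>i\<in>J. \<Sum>j\<in>J. v i * A' i j * v j)
          = (\<Sum>i\<in>J. \<Sum>j\<in>J. v i * A i j * v j) - ?b * ?b / A k k"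
        unfolding A'_def sum_product
        by (simp add: algebra_simps sum_subtractf sum_divide_distrib)
      also have "\<dots> \<ge> 0"
        \<comment> \<open>The form of \<open>A'\<close> at \<open>v\<close> is the minimum of the form of \<open>A\<close> over the \<open>k\<close>-th coordinate.\<close>
        using quad[of "- ?b / A k k" v] pos by (simp add: power2_eq_square field_simps)
      finally show "0 \<le> (\<Sum>i\<in>J. \<Sum>j\<in>J. v i * A' i j * v j)" .
    qed
    moreover have "A' i j = A' j i" if "i \<in> J" "j \<in> J" for i j
      using insert.prems(3) that by (simp add: A'_def mult.commute)
    ultimately have "0 \<le> (\<Sum>i\<in>J. \<Sum>j\<in>J. A' i j * B i j)"
      using insert.IH psdB by blast
    moreover have "0 \<le> (\<Sum>i\<in>insert k J. \<Sum>j\<in>insert k J. A k i * B i j * A k j) / A k k"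
      using psd_onD[OF insert.prems(2), of "A k"] pos by simp
    moreover have "(\<Sum>i\<in>insert k J. \<Sum>j\<in>insert k J. A k i * B i j * A k j) / A k k =
       A k k * B k k + (\<Sum>j\<in>J. A k j * B k j) + (\<Sum>i\<in>J. A k i * B i k)
       + (\<Sum>i\<in>J. \<Sum>j\<in>J. A k i * A k j / A k k * B i j)"
      using fin k pos
      by (simp add: sum.distrib add_divide_distrib sum_divide_distrib algebra_simps)
    moreover have "(\<Sum>i\<in>J. \<Sum>j\<in>J. A' i j * B i j) =
       (\<Sum>i\<in>J. \<Sum>j\<in>J. A i j * B i j) - (\<Sum>i\<in>J. \<Sum>j\<in>J. A k i * A k j / A k k * B i j)"
      by (simp add: A'_def algebra_simps sum_subtractf)
    ultimately show ?thesis
      unfolding split by linarith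
  qed
qed

text \<open>
  One half of the Schur complement criterion: the value of the large form at a vector
  whose last coordinate is the minimizer \<open>- (\<Sum>i. u i * v i)\<close> is the value of the small one.
\<close>
lemma psd_on_bordered_imp:
  fixes u :: "nat \<Rightarrow> real"
  assumes "psd_on {..<Suc n} F" "F n n = 1"
    "\<And>i. i < n \<Longrightarrow> F i n = u i" "\<And>i. i < n \<Longrightarrow> F n i = u i"
  shows "psd_on {..<n} (\<lambda>i j. F i j - u i * u j)"
  unfolding psd_on_def
proof
  fix v
  let ?b = "\<Sum>i<n. u i * v i"
  let ?w = "v(n := - ?b)"
  have "(\<Sum>i<Suc n. \<Sum>j<Suc n. ?w i * F i j * ?w j)
      = (\<Sum>i<n. (\<Sum>j<n. v i * F i j * v j) + v i * u i * (- ?b)) + ((\<Sum>j<n. - ?b * u j * v j) + ?b * ?b)"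
    using assms(2-4) by simp
  also have "\<dots> = (\<Sum>i<n. \<Sum>j<n. v i * F i j * v j) - ?b * ?b"
  proof -
    have "(\<Sum>i<n. v i * u i * (- ?b)) = - ?b * ?b" "(\<Sum>j<n. - ?b * u j * v j) = - ?b * ?b"
      unfolding sum_distrib_left by (simp_all add: sum_distrib_right mult_ac)
    then show ?thesis
      unfolding sum.distrib by simp
  qed
  also have "\<dots> = (\<Sum>i<n. \<Sum>j<n. v i * (F i j - u i * u j) * v j)"
    unfolding sum_product by (simp add: algebra_simps sum_subtractf)
  finally show "0 \<le> (\<Sum>i<n. \<Sum>j<n. v i * (F i j - u i * u j) * v j)"
    using psd_onD[OF assms(1), of ?w] by simp
qed


section \<open>Conditions that are definable by linear matrix inequalities\<close>

text \<open>
  Conditions are predicates on valuations \<open>z\<close> of the variables. Points and lifting variables are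
  treated alike until the very end, when the projection tells them apart.
\<close>
definition affine_in :: "'k set \<Rightarrow> (('k \<Rightarrow> real) \<Rightarrow> real) \<Rightarrow> bool" where
  "affine_in V f \<longleftrightarrow> (\<exists>a c. \<forall>z. f z = a + (\<Sum>k\<in>V. c k * z k))"

lemma affine_in_const: "affine_in V (\<lambda>z. a)"
  unfolding affine_in_def by (rule exI[of _ a], rule exI[of _ "\<lambda>_. 0"]) simp

lemma affine_in_var:
  assumes "finite V" "k \<in> V"
  shows "affine_in V (\<lambda>z. z k)"
  unfolding affine_in_def using assms
  by (intro exI[of _ 0] exI[of _ "\<lambda>i. if i = k then 1 else 0"])
     (simp add: if_distrib[of "\<lambda>x. x * _"] cong: if_cong)

lemma affine_in_add:
  assumes "affine_in V f" "affine_in V g"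
  shows "affine_in V (\<lambda>z. f z + g z)"
proof -
  obtain a c b e where "\<And>z. f z = a + (\<Sum>k\<in>V. c k * z k)" "\<And>z. g z = b + (\<Sum>k\<in>V. e k * z k)"
    using assms unfolding affine_in_def by metis
  then have "f z + g z = (a + b) + (\<Sum>k\<in>V. (c k + e k) * z k)" for z
    by (simp add: algebra_simps sum.distrib)
  then show ?thesis unfolding affine_in_def by metis
qed

lemma affine_in_mult_left:
  assumes "affine_in V f"
  shows "affine_in V (\<lambda>z. r * f z)"
proof -
  obtain a c where "\<And>z. f z = a + (\<Sum>k\<in>V. c k * z k)"
    using assms unfolding affine_in_def by metis
  then have "r * f z = r * a + (\<Sum>k\<in>V. (r * c k) * z k)" for z
    by (simp add: algebra_simps sum_distrib_left)
  then show ?thesis unfolding affine_in_def by metis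
qed

lemma affine_in_mult_right: "affine_in V f \<Longrightarrow> affine_in V (\<lambda>z. f z * r)"
  using affine_in_mult_left[of V f r] by (simp add: mult.commute)

lemma affine_in_uminus: "affine_in V f \<Longrightarrow> affine_in V (\<lambda>z. - f z)"
  using affine_in_mult_left[of V f "-1"] by simp

lemma affine_in_diff: "affine_in V f \<Longrightarrow> affine_in V g \<Longrightarrow> affine_in V (\<lambda>z. f z - g z)"
  using affine_in_add[of V f "\<lambda>z. - g z"] affine_in_uminus[of V g] by simp

lemma affine_in_sum:
  "(\<And>i. i \<in> S \<Longrightarrow> affine_in V (f i)) \<Longrightarrow> affine_in V (\<lambda>z. \<Sum>i\<in>S. f i z)"
  by (induction S rule: infinite_finite_induct) (simp_all add: affine_in_const affine_in_add)

lemmas affine_in_intros = affine_in_const affine_in_add affine_in_mult_left affine_in_mult_right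
  affine_in_diff affine_in_sum

definition lmi_definable :: "'k set \<Rightarrow> (('k \<Rightarrow> real) \<Rightarrow> bool) \<Rightarrow> bool" where
  "lmi_definable V C \<longleftrightarrow> (\<exists>(m::nat) F.
     (\<forall>r<m. \<forall>s<m. affine_in V (\<lambda>z. F z r s)) \<and>
     (\<forall>z. \<forall>r<m. \<forall>s<m. F z r s = F z s r) \<and>
     (\<forall>z. C z \<longleftrightarrow> psd_on {..<m} (F z)))"

lemma lmi_definable_psd_on:
  fixes F :: "('k \<Rightarrow> real) \<Rightarrow> 'i \<Rightarrow> 'i \<Rightarrow> real"
  assumes "finite I" "\<And>i j. i \<in> I \<Longrightarrow> j \<in> I \<Longrightarrow> affine_in V (\<lambda>z. F z i j)"
    and "\<And>z i j. i \<in> I \<Longrightarrow> j \<in> I \<Longrightarrow> F z i j = F z j i"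
  shows "lmi_definable V (\<lambda>z. psd_on I (F z))"
proof -
  obtain h where "bij_betw h {0..<card I} I"
    using ex_bij_betw_nat_finite[OF assms(1)] by blast
  then have h: "inj_on h {..<card I}" "h ` {..<card I} = I"
    by (auto simp: bij_betw_def atLeast0LessThan)
  have mem: "h r \<in> I" if "r < card I" for r
    using h(2) that by auto
  have "psd_on I (F z) \<longleftrightarrow> psd_on {..<card I} (\<lambda>r s. F z (h r) (h s))" for z
    using psd_on_reindex[OF h(1), of "F z"] by (simp add: h(2))
  then show ?thesis
    unfolding lmi_definable_def using assms(2,3) mem
    by (intro exI[of _ "card I"] exI[of _ "\<lambda>z r s. F z (h r) (h s)"]) simp
qed

lemma lmi_definable_conj:
  assumes "lmi_definable V C" "lmi_definable V D"
  shows "lmi_definable V (\<lambda>z. C z \<and> D z)"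
proof -
  obtain m F where F: "\<And>r s. r < m \<Longrightarrow> s < m \<Longrightarrow> affine_in V (\<lambda>z. F z r s)"
    "\<And>z r s. r < m \<Longrightarrow> s < m \<Longrightarrow> F z r s = F z s r" "\<And>z. C z \<longleftrightarrow> psd_on {..<m::nat} (F z)"
    using assms(1) unfolding lmi_definable_def by metis
  obtain l G where G: "\<And>r s. r < l \<Longrightarrow> s < l \<Longrightarrow> affine_in V (\<lambda>z. G z r s)"
    "\<And>z r s. r < l \<Longrightarrow> s < l \<Longrightarrow> G z r s = G z s r" "\<And>z. D z \<longleftrightarrow> psd_on {..<l::nat} (G z)"
    using assms(2) unfolding lmi_definable_def by metis
  have "lmi_definable V (\<lambda>z. psd_on ({..<m} <+> {..<l}) (block_diag (F z) (G z)))"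
  proof (rule lmi_definable_psd_on)
    fix i j assume "i \<in> {..<m} <+> {..<l}" "j \<in> {..<m} <+> {..<l}"
    then show "affine_in V (\<lambda>z. block_diag (F z) (G z) i j)"
      by (auto simp: F(1) G(1) affine_in_const)
  next
    fix z i j assume "i \<in> {..<m} <+> {..<l}" "j \<in> {..<m} <+> {..<l}"
    then show "block_diag (F z) (G z) i j = block_diag (F z) (G z) j i"
      by (auto simp: F(2) G(2))
  qed simp
  then show ?thesis
    by (simp add: psd_on_block_diag F(3) G(3))
qed

lemma lmi_definable_nonneg:
  assumes "affine_in V f"
  shows "lmi_definable V (\<lambda>z. 0 \<le> f z)"
proof -
  have "psd_on {()} (\<lambda>_ _. f z) \<longleftrightarrow> 0 \<le> f z" for z
  proof
    assume "psd_on {()} (\<lambda>_ _. f z)"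
    from psd_onD[OF this, of "\<lambda>_. 1"] show "0 \<le> f z" by simp
  next
    assume "0 \<le> f z"
    then show "psd_on {()} (\<lambda>_ _. f z)"
      by (auto simp: psd_on_def mult.commute[of _ "f z"] mult.assoc)
  qed
  moreover have "lmi_definable V (\<lambda>z. psd_on {()} (\<lambda>_ _. f z))"
    by (rule lmi_definable_psd_on) (simp_all add: assms)
  ultimately show ?thesis by simp
qed

lemma lmi_definable_eq:
  assumes "affine_in V f" "affine_in V g"
  shows "lmi_definable V (\<lambda>z. f z = g z)"
proof -
  have "lmi_definable V (\<lambda>z. 0 \<le> f z - g z \<and> 0 \<le> g z - f z)"
    by (intro lmi_definable_conj lmi_definable_nonneg affine_in_diff assms)
  moreover have "f z = g z \<longleftrightarrow> 0 \<le> f z - g z \<and> 0 \<le> g z - f z" for z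
    by auto
  ultimately show ?thesis by simp
qed

lemma lmi_definable_ball:
  assumes "finite S" "\<And>s. s \<in> S \<Longrightarrow> lmi_definable V (C s)"
  shows "lmi_definable V (\<lambda>z. \<forall>s\<in>S. C s z)"
  using assms
proof (induction S rule: finite_induct)
  case empty
  have "lmi_definable V (\<lambda>z. (0::real) = 0)"
    by (intro lmi_definable_eq affine_in_const)
  then show ?case by simp
next
  case (insert s S)
  then show ?case
    using lmi_definable_conj[of V "C s" "\<lambda>z. \<forall>s\<in>S. C s z"] by simp
qed

lemma psd_mat_mat_iff:
  assumes "\<And>r s. r < m \<Longrightarrow> s < m \<Longrightarrow> F r s = F s r"
  shows "psd_mat (mat m m (\<lambda>(r, s). F r s)) \<longleftrightarrow> psd_on {..<m} F"
proof -
  let ?M = "mat m m (\<lambda>(r, s). F r s)"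
  have "square_mat ?M" "transpose_mat ?M = ?M"
    using assms by (auto intro!: eq_matI)
  moreover have form: "v \<bullet> (?M *\<^sub>v v) = (\<Sum>i<m. \<Sum>j<m. v $ i * F i j * v $ j)"
    if "v \<in> carrier_vec m" for v
    using that by (simp add: scalar_prod_def atLeast0LessThan sum_distrib_left mult.assoc)
  moreover have "(\<forall>v\<in>carrier_vec m. 0 \<le> (\<Sum>i<m. \<Sum>j<m. v $ i * F i j * v $ j)) \<longleftrightarrow> psd_on {..<m} F"
  proof
    assume *: "\<forall>v\<in>carrier_vec m. 0 \<le> (\<Sum>i<m. \<Sum>j<m. v $ i * F i j * v $ j)"
    show "psd_on {..<m} F"
      unfolding psd_on_def using *[rule_format, of "vec m v" for v] by simp
  qed (simp add: psd_onD)
  ultimately show ?thesis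
    unfolding psd_mat_def by simp
qed

text \<open>
  The coefficient matrices of the variables \<open>X 0, \<dots>, X (n - 1)\<close> become the matrices \<open>A\<close> of the pencil,
  and the remaining variables in \<open>V\<close>, in any enumeration, become the lifting variables.
\<close>
lemma lmi_definable_imp_sdp_representable:
  assumes "lmi_definable V C" "finite V" "inj_on X {..<n}" "X ` {..<n} \<subseteq> V"
  shows "sdp_representable n {x \<in> carrier_vec n. \<exists>z. (\<forall>i<n. z (X i) = x $ i) \<and> C z}"
proof -
  obtain m F where F: "\<And>r s. r < m \<Longrightarrow> s < m \<Longrightarrow> affine_in V (\<lambda>z. F z r s)"
    "\<And>z r s. r < m \<Longrightarrow> s < m \<Longrightarrow> F z r s = F z s r" "\<And>z. C z \<longleftrightarrow> psd_on {..<m::nat} (F z)"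
    using assms(1) unfolding lmi_definable_def by metis
  have "\<exists>a c. \<forall>z. r < m \<longrightarrow> s < m \<longrightarrow> F z r s = a + (\<Sum>k\<in>V. c k * z k)" for r s
    using F(1)[of r s] unfolding affine_in_def by blast
  then obtain a c where Fac: "\<And>r s z. r < m \<Longrightarrow> s < m \<Longrightarrow> F z r s = a r s + (\<Sum>k\<in>V. c r s k * z k)"
    by metis
  define W where "W = V - X ` {..<n}"
  have "finite W" using assms(2) by (simp add: W_def)
  obtain h where "bij_betw h {0..<card W} W"
    using ex_bij_betw_nat_finite[OF \<open>finite W\<close>] by blast
  then have h: "inj_on h {..<card W}" "h ` {..<card W} = W"
    by (auto simp: bij_betw_def atLeast0LessThan)
  \<comment> \<open>The coefficients of a symmetric affine matrix are symmetrized explicitly, which leaves the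
    matrix itself unchanged.\<close>
  define S :: "(nat \<Rightarrow> nat \<Rightarrow> real) \<Rightarrow> real mat" where
    "S f = mat m m (\<lambda>(r, s). (f r s + f s r) / 2)" for f
  define A where "A i = (case i of 0 \<Rightarrow> S a | Suc l \<Rightarrow> S (\<lambda>r s. c r s (X l)))" for i
  define B where "B j = S (\<lambda>r s. c r s (h j))" for j
  have S: "S f \<in> carrier_mat m m \<and> transpose_mat (S f) = S f" for f
    by (auto simp: S_def intro!: eq_matI)
  have A: "A i \<in> carrier_mat m m \<and> transpose_mat (A i) = A i" for i
    using S by (simp add: A_def split: nat.split)
  have B: "B j \<in> carrier_mat m m \<and> transpose_mat (B j) = B j" for j
    using S by (simp add: B_def)
  have pencil: "psd_mat (linear_pencil m n (card W) A B x y) \<longleftrightarrow> C z"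
    if x: "\<And>i. i < n \<Longrightarrow> z (X i) = x $ i" and y: "\<And>j. j < card W \<Longrightarrow> z (h j) = y $ j" for x y z
  proof -
    have sumV: "(\<Sum>k\<in>V. g k * z k) = (\<Sum>i<n. x $ i * g (X i)) + (\<Sum>j<card W. y $ j * g (h j))" for g
    proof -
      have "(\<Sum>k\<in>V. g k * z k) = (\<Sum>k\<in>W. g k * z k) + (\<Sum>k\<in>X ` {..<n}. g k * z k)"
        unfolding W_def using assms(2,4) by (rule sum.subset_diff[rotated])
      also have "(\<Sum>k\<in>W. g k * z k) = (\<Sum>j<card W. y $ j * g (h j))"
        using sum.reindex[OF h(1), of "\<lambda>k. g k * z k"] y by (simp add: h(2) mult.commute)
      also have "(\<Sum>k\<in>X ` {..<n}. g k * z k) = (\<Sum>i<n. x $ i * g (X i))"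
        unfolding sum.reindex[OF assms(3)] using x by (simp add: mult.commute)
      finally show ?thesis by simp
    qed
    have "linear_pencil m n (card W) A B x y = mat m m (\<lambda>(r, s). F z r s)"
    proof (rule eq_matI)
      fix r s assume "r < dim_row (mat m m (\<lambda>(r, s). F z r s))" "s < dim_col (mat m m (\<lambda>(r, s). F z r s))"
      then have rs: "r < m" "s < m" by auto
      have "F z r s = (F z r s + F z s r) / 2"
        using F(2)[OF rs] by simp
      also have "\<dots> = (a r s + a s r) / 2 + (\<Sum>k\<in>V. ((c r s k + c s r k) / 2) * z k)"
        using rs by (simp add: Fac add_divide_distrib distrib_right sum.distrib sum_divide_distrib)
      also have "\<dots> = linear_pencil m n (card W) A B x y $$ (r, s)"
        unfolding sumV using rs by (simp add: linear_pencil_def A_def B_def S_def)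
      finally show "linear_pencil m n (card W) A B x y $$ (r, s) = mat m m (\<lambda>(r, s). F z r s) $$ (r, s)"
        using rs by simp
    qed (auto simp: linear_pencil_def)
    then show ?thesis
      using psd_mat_mat_iff[of m "F z"] F(2,3) by simp
  qed
  have "(\<exists>z. (\<forall>i<n. z (X i) = x $ i) \<and> C z) \<longleftrightarrow>
      (\<exists>y\<in>carrier_vec (card W). psd_mat (linear_pencil m n (card W) A B x y))" for x
  proof
    assume "\<exists>z. (\<forall>i<n. z (X i) = x $ i) \<and> C z"
    then obtain z where "\<And>i. i < n \<Longrightarrow> z (X i) = x $ i" "C z" by blast
    then show "\<exists>y\<in>carrier_vec (card W). psd_mat (linear_pencil m n (card W) A B x y)"
      using pencil[of z x "vec (card W) (\<lambda>j. z (h j))"]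
      by (intro bexI[of _ "vec (card W) (\<lambda>j. z (h j))"]) auto
  next
    assume "\<exists>y\<in>carrier_vec (card W). psd_mat (linear_pencil m n (card W) A B x y)"
    then obtain y where y: "psd_mat (linear_pencil m n (card W) A B x y)" by blast
    \<comment> \<open>The values outside \<open>V\<close> are irrelevant, because \<open>C z\<close> only depends on \<open>z\<close> through affine
      functions of the variables in \<open>V\<close>.\<close>
    define z where "z k = (if k \<in> W then y $ inv_into {..<card W} h k
        else x $ inv_into {..<n} X k)" for k
    have 1: "z (X i) = x $ i" if "i < n" for i
      using that assms(3) by (simp add: z_def W_def)
    have 2: "z (h j) = y $ j" if "j < card W" for j
      using that h by (auto simp: z_def)
    show "\<exists>z. (\<forall>i<n. z (X i) = x $ i) \<and> C z"
      using pencil[OF 1 2] 1 y by blast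
  qed
  then show ?thesis
    unfolding sdp_representable_def using A B
    by (intro exI[of _ "card W"] exI[of _ m] exI[of _ A] exI[of _ B]) simp
qed


section \<open>Nonnegative univariate polynomials\<close>

text \<open>
  A nonconstant polynomial is unbounded at infinity, so outside a compact interval a nonnegative one
  is at least its value at \<open>0\<close>.
\<close>
lemma poly_nonneg_attains_min:
  fixes q :: "real poly"
  assumes "\<And>s. 0 \<le> poly q s"
  obtains a where "\<And>s. poly q a \<le> poly q s"
proof (cases "degree q = 0")
  case True
  then obtain c where "q = [:c:]" by (rule degree_eq_zeroE)
  then show ?thesis using that[of 0] by simp
next
  case False
  obtain c p where q: "q = pCons c p" by (cases q)
  with False have "p \<noteq> 0" by auto
  from poly_infinity[OF this, of "poly q 0" c]
  obtain r where r: "\<And>s. r \<le> \<bar>s\<bar> \<Longrightarrow> poly q 0 \<le> poly q s"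
    using assms by (auto simp: q)
  define R where "R = max r 0"
  obtain M a where M: "\<And>s. -R \<le> s \<Longrightarrow> s \<le> R \<Longrightarrow> M \<le> poly q s" "poly q a = M"
    using isCont_eq_Lb[of "-R" R "poly q"] by (auto simp: R_def)
  have "poly q a \<le> poly q s" for s
  proof (cases "\<bar>s\<bar> \<le> R")
    case True
    then show ?thesis using M by auto
  next
    case False
    have "poly q a \<le> poly q 0"
      using M(1)[of 0] M(2) by (simp add: R_def)
    also have "\<dots> \<le> poly q s"
      using False by (intro r) (simp add: R_def)
    finally show ?thesis .
  qed
  then show ?thesis by (rule that)
qed

lemma poly_nonneg_at_left_limit:
  fixes q :: "real poly"
  assumes "\<And>s. s > a \<Longrightarrow> 0 \<le> poly q s"
  shows "0 \<le> poly q a"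
proof -
  have "(poly q \<longlongrightarrow> poly q a) (at_right a)"
    using isCont_def poly_isCont[of a q] filterlim_at_split by blast
  moreover have "\<forall>\<^sub>F s in at_right a. 0 \<le> poly q s"
    using assms by (auto simp: eventually_at_filter)
  ultimately show ?thesis
    using tendsto_lowerbound trivial_limit_at_right_real by blast
qed

text \<open>
  The factor \<open>s - a\<close> changes its sign at \<open>a\<close>, so the cofactor has to change its sign as well and
  therefore vanishes at \<open>a\<close>.
\<close>
lemma poly_nonneg_root_double:
  fixes q :: "real poly"
  assumes nn: "\<And>s. 0 \<le> poly q s" and root: "poly q a = 0"
  obtains r where "q = [:- a, 1:]\<^sup>2 * r" "\<And>s. 0 \<le> poly r s"
proof -
  obtain h where h: "q = [:- a, 1:] * h"
    using root by (auto simp: poly_eq_0_iff_dvd dvd_def)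
  have qh: "poly q s = (s - a) * poly h s" for s
    by (simp add: h algebra_simps)
  have "0 \<le> poly h a"
  proof (rule poly_nonneg_at_left_limit)
    fix s assume "s > a"
    then show "0 \<le> poly h s" using nn[of s] by (simp add: qh zero_le_mult_iff)
  qed
  moreover have "0 \<le> poly (- pcompose h [:0, -1:]) (-a)"
  proof (rule poly_nonneg_at_left_limit)
    fix s assume "s > -a"
    then show "0 \<le> poly (- pcompose h [:0, -1:]) s"
      using nn[of "-s"] by (simp add: qh poly_pcompose zero_le_mult_iff)
  qed
  \<comment> \<open>So \<open>h\<close> is nonnegative to the right of \<open>a\<close> and, by reflection, nonpositive to the left of it.\<close>
  ultimately have "poly h a = 0"
    by (simp add: poly_pcompose)
  then obtain r where r: "h = [:- a, 1:] * r"
    by (auto simp: poly_eq_0_iff_dvd dvd_def)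
  have qr: "poly q s = (s - a)\<^sup>2 * poly r s" for s
    by (simp add: qh r power2_eq_square algebra_simps)
  have pos: "0 \<le> poly r s" if "s \<noteq> a" for s
    using nn[of s] that by (simp add: qr zero_le_mult_iff)
  then have "0 \<le> poly r s" for s
    using poly_nonneg_at_left_limit[of a r] by (cases "s = a") auto
  moreover have "q = [:- a, 1:]\<^sup>2 * r"
    by (simp only: h r power2_eq_square mult.assoc)
  ultimately show ?thesis using that by blast
qed

text \<open>
  Subtracting the minimum \<open>m\<close>, attained at \<open>a\<close>, leaves a nonnegative polynomial with a double root
  at \<open>a\<close>; the cofactor of \<open>(s - a)\<^sup>2\<close> is a sum of squares by induction on the degree, and \<open>m\<close> is the
  square of \<open>sqrt m\<close>.
\<close>
lemma poly_nonneg_imp_sum_of_squares: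
  fixes q :: "real poly"
  assumes "\<And>s. 0 \<le> poly q s" "degree q \<le> 2 * d"
  shows "\<exists>fs. q = (\<Sum>f\<leftarrow>fs. f\<^sup>2) \<and> (\<forall>f\<in>set fs. degree f \<le> d)"
  using assms
proof (induction d arbitrary: q)
  case 0
  then have "degree q = 0" by simp
  then obtain c where q: "q = [:c:]" by (rule degree_eq_zeroE)
  then have "0 \<le> c" using "0.prems"(1)[of 0] by simp
  then have "q = [:sqrt c:]\<^sup>2" by (simp add: q power2_eq_square)
  then show ?case by (intro exI[of _ "[[:sqrt c:]]"]) simp
next
  case (Suc d)
  obtain a where a: "\<And>s. poly q a \<le> poly q s"
    using poly_nonneg_attains_min Suc.prems(1) by blast
  define m where "m = poly q a"
  have m: "0 \<le> m" using Suc.prems(1) by (simp add: m_def)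
  have "0 \<le> poly (q - [:m:]) s" for s
    using a[of s] by (simp add: m_def)
  moreover have "poly (q - [:m:]) a = 0"
    by (simp add: m_def)
  ultimately obtain r where r: "q - [:m:] = [:- a, 1:]\<^sup>2 * r" "\<And>s. 0 \<le> poly r s"
    using poly_nonneg_root_double by blast
  have "degree r \<le> 2 * d"
  proof (cases "r = 0")
    case False
    have "degree (q - [:m:]) = 2 + degree r"
      unfolding r(1) using False by (subst degree_mult_eq) (auto simp: degree_power_eq)
    moreover have "degree (q - [:m:]) \<le> 2 * Suc d"
      using Suc.prems(2) by (intro degree_diff_le) auto
    ultimately show ?thesis by simp
  qed simp
  from Suc.IH[OF r(2) this] obtain fs
    where fs: "r = (\<Sum>f\<leftarrow>fs. f\<^sup>2)" "\<forall>f\<in>set fs. degree f \<le> d" by blast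
  define gs where "gs = [:sqrt m:] # map (\<lambda>f. [:- a, 1:] * f) fs"
  have "(\<Sum>f\<leftarrow>gs. f\<^sup>2) = [:m:] + (\<Sum>f\<leftarrow>fs. [:- a, 1:]\<^sup>2 * f\<^sup>2)"
    using m by (simp add: gs_def power2_eq_square o_def mult_ac del: mult_pCons_left mult_pCons_right)
       simp
  also have "\<dots> = q"
    using r(1) by (simp add: fs(1) sum_list_const_mult sum_list_mult_const algebra_simps)
  finally have "q = (\<Sum>f\<leftarrow>gs. f\<^sup>2)" by simp
  moreover have "degree f \<le> Suc d" if "f \<in> set gs" for f
  proof -
    have "degree ([:- a, 1:] * g) \<le> Suc d" if "g \<in> set fs" for g
      using degree_mult_le[of "[:- a, 1:]" g] fs(2) that by fastforce
    then show ?thesis using that by (auto simp: gs_def)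
  qed
  ultimately show ?case by blast
qed

lemma poly_eq_sum_atMost:
  fixes f :: "'a::comm_semiring_1 poly"
  assumes "degree f \<le> d"
  shows "poly f s = (\<Sum>i\<le>d. coeff f i * s ^ i)"
proof -
  have "poly f s = (\<Sum>i\<le>degree f. coeff f i * s ^ i)"
    by (rule poly_altdef)
  also have "\<dots> = (\<Sum>i\<le>d. coeff f i * s ^ i)"
    using assms by (intro sum.mono_neutral_left) (auto simp: coeff_eq_0)
  finally show ?thesis .
qed

text \<open>
  Each square \<open>f\<^sup>2\<close> contributes the rank-one matrix formed from the coefficients of \<open>f\<close>.
\<close>
lemma poly_nonneg_imp_gram:
  fixes q :: "real poly"
  assumes "\<And>s. 0 \<le> poly q s" "degree q \<le> 2 * d"
  obtains G where "psd_on {..d} G" "\<And>i j. G i j = G j i"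
    "\<And>s. poly q s = (\<Sum>i\<le>d. \<Sum>j\<le>d. s ^ i * G i j * s ^ j)"
proof -
  obtain fs where fs: "q = (\<Sum>f\<leftarrow>fs. f\<^sup>2)" "\<forall>f\<in>set fs. degree f \<le> d"
    using poly_nonneg_imp_sum_of_squares[OF assms] by blast
  define G where "G i j = (\<Sum>f\<leftarrow>fs. coeff f i * coeff f j)" for i j
  have "psd_on {..d} (\<lambda>i j. \<Sum>f\<leftarrow>fs. coeff f i * coeff f j)"
  proof (induction fs)
    case Nil
    then show ?case by (simp add: psd_on_def)
  next
    case (Cons f fs)
    then show ?case by (simp add: psd_on_add psd_on_rank_one)
  qed
  moreover have "poly (\<Sum>f\<leftarrow>fs. f\<^sup>2) s =
      (\<Sum>i\<le>d. \<Sum>j\<le>d. s ^ i * (\<Sum>f\<leftarrow>fs. coeff f i * coeff f j) * s ^ j)" for s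
    using fs(2)
  proof (induction fs)
    case Nil
    then show ?case by simp
  next
    case (Cons f fs)
    have "poly (f\<^sup>2) s = (\<Sum>i\<le>d. \<Sum>j\<le>d. s ^ i * (coeff f i * coeff f j) * s ^ j)"
      using Cons.prems poly_eq_sum_atMost[of f d s]
      by (simp add: power2_eq_square sum_product mult_ac)
    then show ?case
      using Cons by (simp add: algebra_simps sum.distrib)
  qed
  ultimately show ?thesis
    using that[of G] by (simp add: G_def[abs_def] fs(1) mult.commute)
qed

text \<open>
  The substitution \<open>t = 2 s / (1 + s\<^sup>2)\<close> maps the real line onto the whole closed interval: the
  endpoints \<open>-1\<close> and \<open>1\<close> are attained at \<open>s = -1\<close> and \<open>s = 1\<close>, so that no limit at infinity has to be
  considered.
\<close>
lemma rational_param_bounds: "2 * s / (1 + s\<^sup>2) \<in> {-1..1::real}"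
proof -
  have "1 + s\<^sup>2 > 0"
    by (simp add: add_pos_nonneg)
  moreover have "0 \<le> (1 + s)\<^sup>2" "0 \<le> (1 - s)\<^sup>2"
    by simp_all
  ultimately show ?thesis
    by (simp add: field_simps power2_eq_square)
qed

lemma rational_param_surj:
  assumes "t \<in> {-1..1::real}"
  obtains s where "t = 2 * s / (1 + s\<^sup>2)"
proof -
  define c where "c = sqrt (1 - t\<^sup>2)"
  have "t\<^sup>2 \<le> 1"
    using assms by (simp add: abs_square_le_1 abs_le_iff)
  then have c: "0 \<le> c" "c\<^sup>2 = 1 - t\<^sup>2"
    by (simp_all add: c_def)
  \<comment> \<open>For \<open>t = sin \<theta>\<close> this is \<open>tan (\<theta> / 2)\<close>.\<close>
  define s where "s = t / (1 + c)"
  have "1 + s\<^sup>2 = ((1 + c)\<^sup>2 + t\<^sup>2) / (1 + c)\<^sup>2"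
    using c(1) by (simp add: s_def power_divide add_divide_distrib)
  also have "(1 + c)\<^sup>2 + t\<^sup>2 = 2 * (1 + c)"
    using c(2) by (simp add: power2_sum)
  also have "2 * (1 + c) / (1 + c)\<^sup>2 = 2 / (1 + c)"
    using nonzero_mult_divide_mult_cancel_right[of "1 + c" 2 "1 + c"] c(1)
    by (simp add: power2_eq_square del: distrib_left_numeral)
  finally have "2 * s / (1 + s\<^sup>2) = t"
    using c(1) by (simp add: s_def)
  then show ?thesis using that by metis
qed

lemma rational_param_poly:
  fixes p :: "real poly"
  assumes "degree p \<le> d"
  obtains q where "degree q \<le> 2 * d" "\<And>s. poly q s = (1 + s\<^sup>2) ^ d * poly p (2 * s / (1 + s\<^sup>2))"
proof -
  have "\<exists>q. degree q \<le> 2 * d \<and> (\<forall>s. poly q s = (1 + s\<^sup>2) ^ d * poly p (2 * s / (1 + s\<^sup>2)))"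
    using assms
  proof (induction d arbitrary: p)
    case 0
    then have "degree p = 0" by simp
    then obtain c where "p = [:c:]" by (rule degree_eq_zeroE)
    then show ?case by (intro exI[of _ p]) simp
  next
    case (Suc d)
    obtain c p' where p: "p = pCons c p'" by (cases p)
    have "degree p' \<le> d"
      using Suc.prems by (cases "p' = 0") (auto simp: p)
    from Suc.IH[OF this] obtain q where q: "degree q \<le> 2 * d"
      "\<And>s. poly q s = (1 + s\<^sup>2) ^ d * poly p' (2 * s / (1 + s\<^sup>2))" by blast
    define q' where "q' = smult c ([:1, 0, 1:] ^ Suc d) + [:0, 2:] * q"
    have "degree ([:1, 0, 1:] ^ Suc d :: real poly) \<le> 2 * Suc d"
      using degree_power_le[of "[:1, 0, 1:] :: real poly" "Suc d"] by simp
    moreover have "degree ([:0, 2:] * q) \<le> 2 * Suc d"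
      using degree_mult_le[of "[:0, 2:]" q] q(1) by simp
    ultimately have "degree q' \<le> 2 * Suc d"
      unfolding q'_def by (intro degree_add_le order.trans[OF degree_smult_le])
    moreover have "poly q' s = (1 + s\<^sup>2) ^ Suc d * poly p (2 * s / (1 + s\<^sup>2))" for s
    proof -
      have "1 + s\<^sup>2 \<noteq> 0"
        using zero_le_power2[of s] by linarith
      then have "(1 + s\<^sup>2) ^ Suc d * (2 * s / (1 + s\<^sup>2)) = 2 * s * (1 + s\<^sup>2) ^ d"
        by simp
      moreover have "poly q' s = c * (1 + s\<^sup>2) ^ Suc d + 2 * s * (1 + s\<^sup>2) ^ d * poly p' (2 * s / (1 + s\<^sup>2))"
        by (simp add: q'_def q(2) poly_power power2_eq_square algebra_simps)
      ultimately show ?thesis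
        by (simp only: p poly_pCons distrib_left mult.assoc[symmetric]) simp
    qed
    ultimately show ?case by blast
  qed
  then show ?thesis using that by blast
qed

text \<open>
  The identity that certifies nonnegativity is between polynomials in \<open>s\<close> of degree at most
  \<open>2 * d\<close>, so it suffices to demand it at \<open>2 * d + 1\<close> points. In this form the certificate consists
  of finitely many conditions that are affine in \<open>p\<close> and in \<open>G\<close>.
\<close>
lemma poly_nonneg_interval_iff_gram:
  fixes p :: "real poly"
  assumes "degree p \<le> d"
  shows "(\<forall>t\<in>{-1..1}. 0 \<le> poly p t) \<longleftrightarrow>
    (\<exists>G. psd_on {..d} G \<and> (\<forall>i j. G i j = G j i) \<and>
      (\<forall>s\<in>real ` {..2 * d}. (1 + s\<^sup>2) ^ d * poly p (2 * s / (1 + s\<^sup>2)) =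
         (\<Sum>i\<le>d. \<Sum>j\<le>d. s ^ i * G i j * s ^ j)))" (is "?L \<longleftrightarrow> ?R")
proof -
  obtain q where q: "degree q \<le> 2 * d" "\<And>s. poly q s = (1 + s\<^sup>2) ^ d * poly p (2 * s / (1 + s\<^sup>2))"
    using rational_param_poly[OF assms] by blast
  have pos: "(1 + s\<^sup>2) ^ d > 0" for s :: real
    by (simp add: add_pos_nonneg)
  have "?L \<longleftrightarrow> (\<forall>s. 0 \<le> poly p (2 * s / (1 + s\<^sup>2)))"
    using rational_param_bounds rational_param_surj by metis
  also have "\<dots> \<longleftrightarrow> (\<forall>s. 0 \<le> poly q s)"
  proof -
    have "0 \<le> a * b \<longleftrightarrow> 0 \<le> b" if "a > 0" for a b :: real
      using that by (simp add: zero_le_mult_iff)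
    then show ?thesis
      by (simp only: q(2) pos)
  qed
  also have "\<dots> \<longleftrightarrow> ?R"
  proof
    assume "\<forall>s. 0 \<le> poly q s"
    then obtain G where "psd_on {..d} G" "\<And>i j. G i j = G j i"
      "\<And>s. poly q s = (\<Sum>i\<le>d. \<Sum>j\<le>d. s ^ i * G i j * s ^ j)"
      using poly_nonneg_imp_gram[OF _ q(1)] by blast
    then show ?R
      by (intro exI[of _ G]) (auto simp flip: q(2))
  next
    assume ?R
    then obtain G where G: "psd_on {..d} G"
      "\<And>s. s \<in> real ` {..2 * d} \<Longrightarrow> poly q s = (\<Sum>i\<le>d. \<Sum>j\<le>d. s ^ i * G i j * s ^ j)"
      unfolding q(2) by blast
    define g where "g = (\<Sum>i\<le>d. \<Sum>j\<le>d. monom (G i j) (i + j))"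
    have g: "poly g s = (\<Sum>i\<le>d. \<Sum>j\<le>d. s ^ i * G i j * s ^ j)" for s
      by (simp add: g_def poly_sum poly_monom power_add mult_ac)
    have "degree g \<le> 2 * d"
      unfolding g_def
      by (intro degree_sum_le order.trans[OF degree_monom_le]) auto
    moreover have "card (real ` {..2 * d}) = Suc (2 * d)"
      by (simp add: card_image inj_on_def)
    ultimately have "q = g"
      using q(1) G(2) by (intro poly_eqI_degree[of "real ` {..2 * d}"]) (auto simp: g)
    then show "\<forall>s. 0 \<le> poly q s"
      using psd_onD[OF G(1)] by (simp add: g)
  qed
  finally show ?thesis .
qed


section \<open>The lifted description of a generalized ellipsoid\<close>

text \<open>
  The variables are the coordinates of \<open>x\<close>, the entries of \<open>Y\<close> and the entries of \<open>G\<close>.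
\<close>
datatype lift_var = Point nat | Moment nat nat | Gram nat nat

definition lift_vars :: "nat \<Rightarrow> nat \<Rightarrow> lift_var set" where
  "lift_vars n d = Point ` {..<n} \<union> (\<lambda>(i, j). Moment i j) ` ({..<n} \<times> {..<n}) \<union>
     (\<lambda>(i, j). Gram i j) ` ({..d} \<times> {..d})"

text \<open>
  Reading only the entries on and above the diagonal makes the matrices symmetric by construction.
\<close>
abbreviation moment :: "(lift_var \<Rightarrow> real) \<Rightarrow> nat \<Rightarrow> nat \<Rightarrow> real" where
  "moment z i j \<equiv> z (Moment (min i j) (max i j))"

abbreviation gram :: "(lift_var \<Rightarrow> real) \<Rightarrow> nat \<Rightarrow> nat \<Rightarrow> real" where
  "gram z i j \<equiv> z (Gram (min i j) (max i j))"

text \<open>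
  The matrix \<open>Y\<close>, bordered in row and column \<open>n\<close> by \<open>x - c\<close> and with \<open>1\<close> in the corner. It is affine in
  \<open>(x, Y)\<close>, and its Schur complement with respect to the corner is \<open>Y - (x - c) (x - c)\<^sup>T\<close>.
\<close>
definition bordered :: "nat \<Rightarrow> (nat \<Rightarrow> real) \<Rightarrow> (lift_var \<Rightarrow> real) \<Rightarrow> nat \<Rightarrow> nat \<Rightarrow> real" where
  "bordered n c z i j =
     (if i = n then if j = n then 1 else z (Point j) - c j
      else if j = n then z (Point i) - c i else moment z i j)"

text \<open>
  The last two conjuncts make \<open>G\<close> a certificate, in the sense of \<open>poly_nonneg_interval_iff_gram\<close>, for
  nonnegativity of \<open>1 - tr (Q(t) Y)\<close> on \<open>[-1, 1]\<close>.
\<close>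
definition lifted :: "nat \<Rightarrow> nat \<Rightarrow> (nat \<Rightarrow> real) \<Rightarrow> (nat \<Rightarrow> nat \<Rightarrow> real poly) \<Rightarrow> (lift_var \<Rightarrow> real) \<Rightarrow> bool" where
  "lifted n d c Q z \<longleftrightarrow> psd_on {..<Suc n} (bordered n c z) \<and> psd_on {..d} (gram z) \<and>
     (\<forall>s\<in>real ` {..2 * d}.
        (1 + s\<^sup>2) ^ d * (1 - (\<Sum>i<n. \<Sum>j<n. moment z i j * poly (Q i j) (2 * s / (1 + s\<^sup>2)))) =
        (\<Sum>i\<le>d. \<Sum>j\<le>d. s ^ i * gram z i j * s ^ j))"

lemma lmi_definable_lifted: "lmi_definable (lift_vars n d) (lifted n d c Q)"
proof -
  have fin: "finite (lift_vars n d)"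
    by (simp add: lift_vars_def)
  have P: "affine_in (lift_vars n d) (\<lambda>z. z (Point i))" if "i < n" for i
    using that by (intro affine_in_var[OF fin]) (auto simp: lift_vars_def)
  have M: "affine_in (lift_vars n d) (\<lambda>z. moment z i j)" if "i < n" "j < n" for i j
    using that by (intro affine_in_var[OF fin]) (auto simp: lift_vars_def image_iff)
  have G: "affine_in (lift_vars n d) (\<lambda>z. gram z i j)" if "i \<le> d" "j \<le> d" for i j
    using that by (intro affine_in_var[OF fin]) (auto simp: lift_vars_def image_iff)
  have "lmi_definable (lift_vars n d) (\<lambda>z. psd_on {..<Suc n} (bordered n c z))"
  proof (rule lmi_definable_psd_on)
    fix i j assume "i \<in> {..<Suc n}" "j \<in> {..<Suc n}"
    then show "affine_in (lift_vars n d) (\<lambda>z. bordered n c z i j)"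
      unfolding bordered_def by (auto simp: less_Suc_eq intro!: affine_in_intros P M)
  qed (auto simp: bordered_def min.commute max.commute)
  moreover have "lmi_definable (lift_vars n d) (\<lambda>z. psd_on {..d} (gram z))"
    by (rule lmi_definable_psd_on) (auto simp: min.commute max.commute intro: G)
  ultimately show ?thesis
    unfolding lifted_def[abs_def]
    by (intro lmi_definable_conj lmi_definable_ball lmi_definable_eq affine_in_intros)
       (auto intro: M G)
qed

text \<open>
  Let \<open>u = x - c\<close>. For a lifted \<open>z\<close> the matrix \<open>Y\<close> dominates \<open>u u\<^sup>T\<close>, so that
  \<open>u\<^sup>T Q(t) u \<le> tr (Q(t) Y) \<le> 1\<close>. Conversely, \<open>Y = u u\<^sup>T\<close> makes the first inequality an equality.
\<close>
lemma quadratic_family_le_one_iff_lifted: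
  fixes Q :: "nat \<Rightarrow> nat \<Rightarrow> real poly"
  assumes deg: "\<And>i j. i < n \<Longrightarrow> j < n \<Longrightarrow> degree (Q i j) \<le> d"
    and sym: "\<And>i j. i < n \<Longrightarrow> j < n \<Longrightarrow> Q i j = Q j i"
    and psd: "\<And>t. t \<in> {-1..1} \<Longrightarrow> psd_on {..<n} (\<lambda>i j. poly (Q i j) t)"
  shows "(\<forall>t\<in>{-1..1}. (\<Sum>i<n. \<Sum>j<n. (x i - c i) * poly (Q i j) t * (x j - c j)) \<le> 1) \<longleftrightarrow>
    (\<exists>z. (\<forall>i<n. z (Point i) = x i) \<and> lifted n d c Q z)"
    (is "?L \<longleftrightarrow> ?R")
proof -
  define u where "u i = x i - c i" for i
  define p where "p Y = 1 - (\<Sum>i<n. \<Sum>j<n. smult (Y i j) (Q i j))" for Y :: "nat \<Rightarrow> nat \<Rightarrow> real"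
  have poly_p: "poly (p Y) t = 1 - (\<Sum>i<n. \<Sum>j<n. Y i j * poly (Q i j) t)" for Y t
    by (simp add: p_def poly_sum)
  have deg_p: "degree (p Y) \<le> d" for Y
    unfolding p_def using deg
    by (intro degree_diff_le degree_sum_le order.trans[OF degree_smult_le]) auto
  note cert = poly_nonneg_interval_iff_gram[OF deg_p, unfolded poly_p]
  show ?thesis
  proof
    assume ?L
    then have "\<forall>t\<in>{-1..1}. 0 \<le> 1 - (\<Sum>i<n. \<Sum>j<n. (u i * u j) * poly (Q i j) t)"
      by (simp add: u_def mult_ac)
    then obtain G where G: "psd_on {..d} G" "\<And>i j. G i j = G j i"
      "\<forall>s\<in>real ` {..2 * d}.
         (1 + s\<^sup>2) ^ d * (1 - (\<Sum>i<n. \<Sum>j<n. (u i * u j) * poly (Q i j) (2 * s / (1 + s\<^sup>2)))) =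
         (\<Sum>i\<le>d. \<Sum>j\<le>d. s ^ i * G i j * s ^ j)"
      using cert[of "\<lambda>i j. u i * u j"] by blast
    define z where "z k = (case k of Point i \<Rightarrow> x i | Moment i j \<Rightarrow> u i * u j | Gram i j \<Rightarrow> G i j)" for k
    have moment: "moment z i j = u i * u j" and gram: "gram z i j = G i j" for i j
      using G(2) by (auto simp: z_def min_def max_def)
    have "bordered n c z = (\<lambda>i j. (if i = n then 1 else u i) * (if j = n then 1 else u j))"
      unfolding bordered_def moment by (auto simp: z_def u_def fun_eq_iff)
    then have "psd_on {..<Suc n} (bordered n c z)"
      using psd_on_rank_one[of "{..<Suc n}" "\<lambda>i. if i = n then 1 else u i"] by simp
    then have "lifted n d c Q z"
      unfolding lifted_def moment gram using G(1,3) by simp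
    moreover have "\<forall>i<n. z (Point i) = x i"
      by (simp add: z_def)
    ultimately show ?R by blast
  next
    assume ?R
    then obtain z where zx: "\<And>i. i < n \<Longrightarrow> z (Point i) = x i" and z: "lifted n d c Q z" by blast
    have le1: "\<forall>t\<in>{-1..1}. 0 \<le> 1 - (\<Sum>i<n. \<Sum>j<n. moment z i j * poly (Q i j) t)"
      unfolding cert using z unfolding lifted_def
      by (intro exI[of _ "gram z"]) (simp add: min.commute max.commute)
    have "psd_on {..<n} (\<lambda>i j. bordered n c z i j - u i * u j)"
    proof (rule psd_on_bordered_imp)
      show "psd_on {..<Suc n} (bordered n c z)"
        using z by (simp add: lifted_def)
    qed (auto simp: bordered_def u_def zx)
    then have Y: "psd_on {..<n} (\<lambda>i j. moment z i j - u i * u j)"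
      by (rule psd_on_cong[THEN iffD1, rotated]) (simp add: bordered_def)
    show ?L
    proof
      fix t :: real assume t: "t \<in> {-1..1}"
      have "0 \<le> (\<Sum>i<n. \<Sum>j<n. poly (Q i j) t * (moment z i j - u i * u j))"
        using psd[OF t] Y sym by (intro psd_on_trace_nonneg) auto
      also have "\<dots> = (\<Sum>i<n. \<Sum>j<n. moment z i j * poly (Q i j) t)
          - (\<Sum>i<n. \<Sum>j<n. u i * poly (Q i j) t * u j)"
        by (simp add: algebra_simps sum_subtractf)
      finally show "(\<Sum>i<n. \<Sum>j<n. (x i - c i) * poly (Q i j) t * (x j - c j)) \<le> 1"
        using le1 t by (fastforce simp: u_def)
    qed
  qed
qed

theorem theorem4p4:
  fixes n :: nat and E :: "real vec set"
  assumes "is_generalized_ellipsoid n E"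
  shows "sdp_representable n E"
proof -
  obtain d x0 P where x0: "x0 \<in> carrier_vec n" and P: "P \<in> carrier_mat n n" "transpose_mat P = P"
    "\<forall>i<n. \<forall>j<n. degree (P $$ (i, j)) \<le> d" "\<forall>t\<in>{-1..1}. psd_mat (eval_poly_mat P t)"
    and E: "E = {x \<in> carrier_vec n.
      \<forall>t\<in>{-1..1}. (x - x0) \<bullet> (eval_poly_mat P t *\<^sub>v (x - x0)) \<le> 1}"
    using assms unfolding is_generalized_ellipsoid_def is_generalized_ellipsoid_of_degree_def
    by blast
  define Q where "Q i j = P $$ (i, j)" for i j
  have sym: "Q i j = Q j i" if "i < n" "j < n" for i j
    using P(1) that arg_cong[OF P(2), of "\<lambda>M. M $$ (i, j)"] by (simp add: Q_def)
  have eval: "eval_poly_mat P t = mat n n (\<lambda>(i, j). poly (Q i j) t)" for t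
    using P(1) by (auto simp: eval_poly_mat_def Q_def intro!: eq_matI)
  have psd: "psd_on {..<n} (\<lambda>i j. poly (Q i j) t)" if "t \<in> {-1..1}" for t
    using P(4) that psd_mat_mat_iff[of n "\<lambda>i j. poly (Q i j) t"] sym by (simp add: eval)
  have form: "(x - x0) \<bullet> (eval_poly_mat P t *\<^sub>v (x - x0)) =
      (\<Sum>i<n. \<Sum>j<n. (x $ i - x0 $ i) * poly (Q i j) t * (x $ j - x0 $ j))"
    if "x \<in> carrier_vec n" for x t
    using that x0 by (simp add: eval scalar_prod_def atLeast0LessThan sum_distrib_left mult.assoc)
  have "E = {x \<in> carrier_vec n. \<exists>z. (\<forall>i<n. z (Point i) = x $ i) \<and> lifted n d (vec_index x0) Q z}"
    unfolding E
  proof (intro Collect_cong conj_cong refl)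
    fix x :: "real vec" assume "x \<in> carrier_vec n"
    then show "(\<forall>t\<in>{-1..1}. (x - x0) \<bullet> (eval_poly_mat P t *\<^sub>v (x - x0)) \<le> 1) \<longleftrightarrow>
        (\<exists>z. (\<forall>i<n. z (Point i) = x $ i) \<and> lifted n d (vec_index x0) Q z)"
      using quadratic_family_le_one_iff_lifted[of n Q d "vec_index x" "vec_index x0"] P(3) sym psd
      by (simp only: form) (simp add: Q_def)
  qed
  moreover have "sdp_representable n
      {x \<in> carrier_vec n. \<exists>z. (\<forall>i<n. z (Point i) = x $ i) \<and> lifted n d (vec_index x0) Q z}"
    by (rule lmi_definable_imp_sdp_representable[OF lmi_definable_lifted])
       (auto simp: lift_vars_def inj_on_def)
  ultimately show ?thesis by simp
qed

end
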